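(* Consider the simple bilevel problem $$\text{(P)}\quad \min_{x\in\mathbb{R}^n} f(x):=f_1(x)+f_2(x)\quad\text{s.t.}\quad x\in X_g^*:=\arg\min_{z\in\mathbb{R}^n} g(z),\qquad g:=g_1+g_2,$$ and assume: (i) $f_1,g_1$ are convex and continuously differentiable, with $L_{f_1}$- and $L_{g_1}$-Lipschitz continuous gradients, respectively; (ii) $f_2,g_2:\mathbb{R}^n\to\mathbb{R}\cup\{\infty\}$ are proper, lower semicontinuous, convex (possibly non-smooth) and proximal-friendly; (iii) $f^*:=\inf_{x\in\mathbb{R}^n} f(x)>-\infty$ and $g^*:=\inf_{x\in\mathbb{R}^n} g(x)>-\infty$, $g$ is not strongly convex, and $X_g^*$ contains more than one point; (iv) for every fixed $c>f^*$, the function $h_c:=g_2+\delta_c$ is proximal-friendly, where $\delta_c(x)=0$ if $f(x)\le c$ and $\delta_c(x)=+\infty$ if $f(x)>c$; (v) $\mathrm{dom}(g_2)$ is bounded, and $f_2$ is $l_{f_2}$-Lipschitz continuous on $\mathrm{dom}(g_2)$; (vi) (Hölderian error bound) for some $\alpha>0$ and $r\ge 1$, $$\frac{\alpha}{r}\,\mathrm{dist}(x,X_g^* )^r\le g(x)-g^*\qquad\forall x\in\mathrm{dom}(g_2).$$ Let $p^*$ be the optimal value of (P), let $B_f:=\sup_{x\in\mathrm{dom}(g_2)}\|\nabla f_1(x)\|+l_{f_2}$, let $\epsilon_f>0$, and set $$\epsilon_g=\frac{\alpha}{r}\left(\frac{\epsilon_f}{B_f}\right)^r.$$ Let $\hat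 x$ be the output of the algorithm Bisec-BiO (described in the context) run with tolerances $\epsilon_f,\epsilon_g$. Then, with an operation complexity of $\tilde{\mathcal{O}}\left(1/\sqrt{\epsilon_f^{\,r}}\right)$, one finds $\hat x$ such that $$|f(\hat x)-p^*|\le\epsilon_f,\qquad g(\hat x)-g^*\le\epsilon_g.$$
   Context: Domains: $f_1,g_1$ are real-valued functions on an open set $X\subseteq\mathbb{R}^n$ containing the effective domains of $f_2$ and $g_2$, so $f,g$ are well-defined functions $\mathbb{R}^n\to\mathbb{R}\cup\{\infty\}$. $\mathrm{dist}$ is Euclidean distance. Proximal-friendly: a function $h$ is proximal-friendly if its proximal mapping $\mathrm{prox}_h(y)=\arg\min_{x\in\mathbb{R}^n} h(x)+\frac12\|x-y\|^2$ is easy to compute; a call of this mapping counts as one unit operation. APG oracle: let $\varphi=\varphi_1+\varphi_2$, where $\varphi_1$ is convex and continuously differentiable with $L_{\varphi_1}$-Lipschitz gradient, and $\varphi_2$ is proper, lower semicontinuous, convex and proximal-friendly. Given a starting point $x_0$ and $\epsilon>0$, the procedure $\mathrm{APG}(\varphi_1,\varphi_2,L_{\varphi_1},x_0,\epsilon)$ runs the classical FISTA scheme (accelerated proximal gradient) and returns, within $\mathcal{O}(\sqrt{L_{\varphi_1}/\epsilon})$ iterations, an $\epsilon$-optimal solution $\tilde x$ of $\min_{x\in\mathbb{R}^n}\varphi(x)$, i.e. $\varphi(\tilde x)-\inf\varphi\le\epsilon$. Each iteration uses a constant number of evaluations of function values, of $\nabla\varphi_1$ and of $\mathrm{prox}$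 of (a multiple of) $\varphi_2$. The constant hidden in $\mathcal{O}(\cdot)$ depends on the distance of the starting point to the solution set; it is treated as one constant common to all oracle calls, independent of $\epsilon_f,\epsilon_g,L_{f_1},L_{g_1}$. The functions $h_c$ to which the oracle is applied are understood to meet the requirements on $\varphi_2$. Algorithm Bisec-BiO (input $f_1,f_2,g_1,g_2,L_{f_1},L_{g_1},\epsilon_f,\epsilon_g$): 1. Compute $\tilde x_f=\mathrm{APG}(f_1,f_2,L_{f_1},x_0^f,\epsilon_f/2)$ and $\tilde x_g=\mathrm{APG}(g_1,g_2,L_{g_1},x_0^g,\epsilon_g/2)$. Set $\tilde g=g(\tilde x_g)$, $l=f(\tilde x_f)-\epsilon_f/2$ and $u=f(\tilde x_g)$ ($l$ and $u$ are real numbers). 2. While $u-l>\epsilon_f$: let $c=\frac{l+u}{2}$ and compute $\tilde x_c=\mathrm{APG}(g_1,h_c,L_{g_1},x_0^c,\epsilon_g/2)$, an approximate solution of $\min_x g(x)$ s.t. $f(x)\le c$ (so $f(\tilde x_c)\le c$). If $g(\tilde x_c)>\tilde g+\epsilon_g/2$, set $l=c$; otherwise set $u=f(\tilde x_c)$. 3. Return as $\hat x$ the point corresponding to the final value of $u$, i.e. the point at which the final value $u$ was attained as its $f$-value (the last $\tilde x_c$ used to update $u$, or $\tilde x_g$ if $u$ was never updated). Operation complexity: the number of unit operations, a unit operation being a function evaluation, a gradient evaluation, or a call of a proximal mapping. The bound is an asymptotic statement as $\epsilon_f\to0$; $\tilde{\mathcal{O}}$ hides a logarithmic factor of order $\log(1/\epsilon_f)$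 and constants depending on the problem data ($L_{f_1},L_{g_1},\alpha,r,B_f$ and the oracle constant). *)

theory Defs
  imports "HOL-Analysis.Analysis"
begin

section \<open>Extended-real-valued functions\<close>

definition effective_domain :: "('a \<Rightarrow> ereal) \<Rightarrow> 'a set" where
  "effective_domain h = {x. h x < \<infinity>}"

definition proper :: "('a \<Rightarrow> ereal) \<Rightarrow> bool" where
  "proper h \<longleftrightarrow> (\<forall>x. h x \<noteq> -\<infinity>) \<and> effective_domain h \<noteq> {}"

definition lsc :: "('a::topological_space \<Rightarrow> ereal) \<Rightarrow> bool" where
  "lsc h \<longleftrightarrow> (\<forall>x. h x \<le> Liminf (at x) h)"

definition convex_ereal :: "('a::real_vector \<Rightarrow> ereal) \<Rightarrow> bool" where
  "convex_ereal h \<longleftrightarrow> convex {(x, t::real). h x \<le> ereal t}"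

definition strongly_convex :: "('a::real_normed_vector \<Rightarrow> ereal) \<Rightarrow> bool" where
  "strongly_convex h \<longleftrightarrow> (\<exists>\<mu>>0. convex_ereal (\<lambda>x. h x - ereal (\<mu> / 2 * (norm x)\<^sup>2)))"

definition minimizers :: "('a \<Rightarrow> ereal) \<Rightarrow> 'a set" where
  "minimizers h = {x. \<forall>z. h x \<le> h z}"

definition composite :: "('a \<Rightarrow> real) \<Rightarrow> ('a \<Rightarrow> ereal) \<Rightarrow> 'a \<Rightarrow> ereal" where
  "composite h1 h2 x = ereal (h1 x) + h2 x"

definition sublevel_indicator :: "('a \<Rightarrow> ereal) \<Rightarrow> real \<Rightarrow> 'a \<Rightarrow> ereal" where
  "sublevel_indicator h c x = (if h x \<le> ereal c then 0 else \<infinity>)"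


section \<open>Smooth parts\<close>

definition gradient :: "('a::real_inner \<Rightarrow> real) \<Rightarrow> 'a \<Rightarrow> 'a" where
  "gradient h x = (THE d. GDERIV h x :> d)"

definition smooth_convex_on :: "'a::real_inner set \<Rightarrow> real \<Rightarrow> ('a \<Rightarrow> real) \<Rightarrow> bool" where
  "smooth_convex_on X L h \<longleftrightarrow>
     convex_on X h \<and> (\<forall>x\<in>X. \<exists>d. GDERIV h x :> d) \<and>
     continuous_on X (gradient h) \<and> L-lipschitz_on X (gradient h)"


section \<open>Proximal-friendly functions\<close>

definition prox :: "('a::real_normed_vector \<Rightarrow> ereal) \<Rightarrow> 'a \<Rightarrow> 'a" where
  "prox h y = arg_min (\<lambda>x. h x + ereal ((norm (x - y))\<^sup>2 / 2)) (\<lambda>_. True)"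

text \<open>
  ``Easy to compute'' is not a mathematical property of a map, so it is a primitive of the
  computational model: \<open>easy\<close> is an arbitrary set of maps, those that the model
  evaluates in one unit operation.
\<close>

definition prox_friendly :: "('a::real_normed_vector \<Rightarrow> 'a) set \<Rightarrow> ('a \<Rightarrow> ereal) \<Rightarrow> bool" where
  "prox_friendly easy h \<longleftrightarrow> prox h \<in> easy"

definition prox_admissible :: "('a::real_normed_vector \<Rightarrow> 'a) set \<Rightarrow> ('a \<Rightarrow> ereal) \<Rightarrow> bool" where
  "prox_admissible easy h \<longleftrightarrow> proper h \<and> lsc h \<and> convex_ereal h \<and> prox_friendly easy h"


section \<open>The simple bilevel problem\<close>

definition optimal_value ::
    "('a \<Rightarrow> real) \<Rightarrow> ('a \<Rightarrow> ereal) \<Rightarrow> ('a \<Rightarrow> real) \<Rightarrow> ('a \<Rightarrow> ereal) \<Rightarrow> ereal" where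
  "optimal_value f1 f2 g1 g2 = (INF x\<in>minimizers (composite g1 g2). composite f1 f2 x)"

definition slope_bound :: "('a::real_inner \<Rightarrow> real) \<Rightarrow> ('a \<Rightarrow> ereal) \<Rightarrow> real \<Rightarrow> real" where
  "slope_bound f1 g2 lf2 = (SUP x\<in>effective_domain g2. norm (gradient f1 x)) + lf2"

locale simple_bilevel =
  fixes X :: "'a::euclidean_space set"
    and f1 :: "'a \<Rightarrow> real" and f2 :: "'a \<Rightarrow> ereal"
    and g1 :: "'a \<Rightarrow> real" and g2 :: "'a \<Rightarrow> ereal"
    and Lf Lg lf2 \<alpha> r :: real
    and easy :: "('a \<Rightarrow> 'a) set"
  assumes X_open: "open X"
    and dom_subset: "effective_domain f2 \<subseteq> X" "effective_domain g2 \<subseteq> X"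
    and smooth: "smooth_convex_on X Lf f1" "smooth_convex_on X Lg g1"
    and nonsmooth: "prox_admissible easy f2" "prox_admissible easy g2"
    and f_bounded_below: "(INF x. composite f1 f2 x) > -\<infinity>"
    and g_bounded_below: "(INF x. composite g1 g2 x) > -\<infinity>"
    and g_not_strongly_convex: "\<not> strongly_convex (composite g1 g2)"
    and several_minimizers:
      "\<exists>x\<in>minimizers (composite g1 g2). \<exists>y\<in>minimizers (composite g1 g2). x \<noteq> y"
    and sublevel_prox_friendly:
      "\<And>c. ereal c > (INF x. composite f1 f2 x) \<Longrightarrow>
         prox_friendly easy (\<lambda>x. g2 x + sublevel_indicator (composite f1 f2) c x)"
    and dom_bounded: "bounded (effective_domain g2)"
    and f2_finite: "effective_domain g2 \<subseteq> effective_domain f2"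
    and f2_lipschitz: "lf2-lipschitz_on (effective_domain g2) (\<lambda>x. real_of_ereal (f2 x))"
    and error_bound_parameters: "\<alpha> > 0" "r \<ge> 1"
    and error_bound: "\<And>x. x \<in> effective_domain g2 \<Longrightarrow>
      ereal (\<alpha> / r * infdist x (minimizers (composite g1 g2)) powr r)
        \<le> composite g1 g2 x - (INF z. composite g1 g2 z)"


section \<open>The APG oracle\<close>

record 'a apg_output =
  point :: 'a
  iterations :: nat
  fun_evals :: nat
  grad_evals :: nat
  prox_calls :: nat

definition unit_ops :: "'a apg_output \<Rightarrow> nat" where
  "unit_ops out = fun_evals out + grad_evals out + prox_calls out"

text \<open>
  The arguments of an oracle are \<open>\<phi>1\<close>, \<open>\<phi>2\<close>, the Lipschitz constant of the gradient of
  \<open>\<phi>1\<close>, the starting point and the tolerance.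
\<close>

type_synonym 'a apg =
  "('a \<Rightarrow> real) \<Rightarrow> ('a \<Rightarrow> ereal) \<Rightarrow> real \<Rightarrow> 'a \<Rightarrow> real \<Rightarrow> 'a apg_output"

text \<open>
  \<open>K\<close> is the constant of the iteration bound and \<open>M\<close> bounds the number of operations of each
  kind per iteration; the summand 1 accounts for rounding up to an integer.
\<close>

definition apg_spec ::
    "'a::real_inner set \<Rightarrow> ('a \<Rightarrow> 'a) set \<Rightarrow> real \<Rightarrow> nat \<Rightarrow>
     ('a \<Rightarrow> real) \<Rightarrow> ('a \<Rightarrow> ereal) \<Rightarrow> real \<Rightarrow> real \<Rightarrow> 'a apg_output \<Rightarrow> bool" where
  "apg_spec X easy K M \<phi>1 \<phi>2 L \<delta> out \<longleftrightarrow>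
     (smooth_convex_on X L \<phi>1 \<and> prox_admissible easy \<phi>2 \<and> effective_domain \<phi>2 \<subseteq> X \<and> \<delta> > 0 \<longrightarrow>
        composite \<phi>1 \<phi>2 (point out) - (INF x. composite \<phi>1 \<phi>2 x) \<le> ereal \<delta> \<and>
        real (iterations out) \<le> K * sqrt (L / \<delta>) + 1 \<and>
        fun_evals out \<le> M * iterations out \<and>
        grad_evals out \<le> M * iterations out \<and>
        prox_calls out \<le> M * iterations out)"


section \<open>Bisec-BiO\<close>

text \<open>
  \<open>incumbent\<close> is the point at which the current value of \<open>upper\<close> was attained;
  \<open>cost\<close> is the number of unit operations spent so far.
\<close>

record 'a bisec_state =
  lower :: real
  upper :: real
  incumbent :: 'a
  cost :: nat

text \<open>
  The starting point of the oracle call in the \<open>k\<close>-th pass of the loop is \<open>x0c k\<close>.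
\<close>

locale bisec_bio =
  fixes f1 :: "'a::euclidean_space \<Rightarrow> real" and f2 :: "'a \<Rightarrow> ereal"
    and g1 :: "'a \<Rightarrow> real" and g2 :: "'a \<Rightarrow> ereal"
    and Lf Lg :: real
    and APG :: "'a apg"
    and x0f x0g :: 'a and x0c :: "nat \<Rightarrow> 'a"
    and \<epsilon>f \<epsilon>g :: real
begin

definition out_f :: "'a apg_output" where
  "out_f = APG f1 f2 Lf x0f (\<epsilon>f / 2)"

definition out_g :: "'a apg_output" where
  "out_g = APG g1 g2 Lg x0g (\<epsilon>g / 2)"

definition h :: "real \<Rightarrow> 'a \<Rightarrow> ereal" where
  "h c x = g2 x + sublevel_indicator (composite f1 f2) c x"

definition out_c :: "nat \<Rightarrow> real \<Rightarrow> 'a apg_output" where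
  "out_c k c = APG g1 (h c) Lg (x0c k) (\<epsilon>g / 2)"

text \<open>The three evaluations are those of \<open>f\<close> at the first point, and of \<open>g\<close> and \<open>f\<close> at the second.\<close>

definition initial :: "'a bisec_state" where
  "initial = \<lparr>
     lower = real_of_ereal (composite f1 f2 (point out_f)) - \<epsilon>f / 2,
     upper = real_of_ereal (composite f1 f2 (point out_g)),
     incumbent = point out_g,
     cost = unit_ops out_f + unit_ops out_g + 3 \<rparr>"

definition running :: "'a bisec_state \<Rightarrow> bool" where
  "running s \<longleftrightarrow> upper s - lower s > \<epsilon>f"

definition mid :: "'a bisec_state \<Rightarrow> real" where
  "mid s = (lower s + upper s) / 2"

text \<open>A pass evaluates \<open>g\<close> at the new point, and \<open>f\<close> only if \<open>upper\<close> is updated.\<close>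

definition pass :: "nat \<Rightarrow> 'a bisec_state \<Rightarrow> 'a bisec_state" where
  "pass k s =
     (let out = out_c k (mid s); x = point out in
      if composite g1 g2 x > composite g1 g2 (point out_g) + ereal (\<epsilon>g / 2)
      then s\<lparr>lower := mid s, cost := cost s + unit_ops out + 1\<rparr>
      else s\<lparr>upper := real_of_ereal (composite f1 f2 x), incumbent := x,
             cost := cost s + unit_ops out + 2\<rparr>)"

primrec state :: "nat \<Rightarrow> 'a bisec_state" where
  "state 0 = initial"
| "state (Suc k) = pass k (state k)"

definition returns :: "'a \<Rightarrow> nat \<Rightarrow> bool" where
  "returns x n \<longleftrightarrow>
     (\<exists>T. (\<forall>k<T. running (state k)) \<and> \<not> running (state T) \<and>
          x = incumbent (state T) \<and> n = cost (state T))"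

definition oracle_calls :: "(('a \<Rightarrow> real) \<times> ('a \<Rightarrow> ereal) \<times> real \<times> 'a \<times> real) set" where
  "oracle_calls =
     {(f1, f2, Lf, x0f, \<epsilon>f / 2), (g1, g2, Lg, x0g, \<epsilon>g / 2)} \<union>
     {(g1, h (mid (state k)), Lg, x0c k, \<epsilon>g / 2) | k. \<forall>j\<le>k. running (state j)}"

end

end

theory Submission
  imports Defs
begin

text \<open>
  Bisection keeps two invariants: \<open>lower\<close> stays below the optimal value \<open>p*\<close>, because raising it to
  \<open>c\<close> requires that every point with \<open>f \<le> c\<close> has a \<open>g\<close>-value above the minimum; and \<open>upper\<close> is the
  \<open>f\<close>-value of a point that is \<open>\<epsilon>g\<close>-optimal for \<open>g\<close>. Hence \<open>f(xhat) \<le> p* + \<epsilon>f\<close> on termination.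
  Conversely, the error bound puts \<open>xhat\<close> within \<open>\<epsilon>f / B\<close> of the minimizers of \<open>g\<close>, and \<open>f\<close> is
  \<open>B\<close>-Lipschitz on the domain of \<open>g2\<close> by the gradient inequality, so \<open>p* \<le> f(xhat) + \<epsilon>f\<close>.
  The interval halves in each pass, so there are \<open>O(log (1 / \<epsilon>f))\<close> passes, each costing
  \<open>O(sqrt (1 / \<epsilon>g)) = O(1 / sqrt (\<epsilon>f powr r))\<close>.
\<close>

section \<open>Gradients and the first-order inequality for convex functions\<close>

lemma GDERIV_gradient:
  assumes "GDERIV h x :> d"
  shows "GDERIV h x :> gradient h x"
  unfolding gradient_def
proof (rule theI[of _ d])
  show "GDERIV h x :> d" by (rule assms)
next
  fix e assume "GDERIV h x :> e"
  then have "(\<lambda>v. inner v e) = (\<lambda>v. inner v d)"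
    using assms unfolding gderiv_def by (rule has_derivative_unique)
  \<comment> \<open>Testing both derivatives in the direction \<open>e - d\<close> gives the squared
    norm of \<open>e - d\<close> equal to zero, so the description in \<open>gradient\<close> is
    unique.\<close>
  then have "inner (e - d) e = inner (e - d) d" by metis
  then show "e = d" by (metis inner_diff_right inner_eq_zero_iff right_minus_eq)
qed

text \<open>By convexity, the difference quotients of \<open>h\<close> along the segment from
  \<open>y\<close> to \<open>x\<close> are at most \<open>h x - h y\<close>; letting the step tend
  to 0 gives the claim. The gradient is taken at \<open>y\<close>, the point at which
  \<open>f_slope_le\<close> bounds the function from above.\<close>

lemma convex_on_gradient_le:
  assumes conv: "convex_on S h" and S: "x \<in> S" "y \<in> S" and d: "GDERIV h y :> d"
  shows "h y - h x \<le> inner (y - x) d"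
proof -
  define \<phi> where "\<phi> t = h (y + t *\<^sub>R (x - y))" for t
  have line: "((\<lambda>t. y + t *\<^sub>R (x - y)) has_derivative (\<lambda>t. t *\<^sub>R (x - y))) (at 0)"
    by (auto intro!: derivative_eq_intros)
  have "(h has_derivative (\<lambda>v. inner v d)) (at (y + 0 *\<^sub>R (x - y)))"
    using d by (simp add: gderiv_def)
  from diff_chain_at[OF line this]
  have "(\<phi> has_derivative (\<lambda>t. inner (t *\<^sub>R (x - y)) d)) (at 0)"
    by (simp add: o_def \<phi>_def[abs_def])
  then have "(\<phi> has_real_derivative inner (x - y) d) (at 0)"
    by (rule has_derivative_imp_has_field_derivative) simp
  then have "((\<lambda>t. (\<phi> t - \<phi> 0) / t) \<longlongrightarrow> inner (x - y) d) (at 0)"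
    by (simp add: DERIV_def)
  \<comment> \<open>Convexity controls the quotient only for \<open>t\<close> between 0 and 1, hence
    the restriction to the right-hand limit.\<close>
  then have lim: "((\<lambda>t. (\<phi> t - \<phi> 0) / t) \<longlongrightarrow> inner (x - y) d) (at_right 0)"
    by (rule tendsto_mono[rotated]) (simp add: at_le)
  have "eventually (\<lambda>t. (\<phi> t - \<phi> 0) / t \<le> h x - h y) (at_right 0)"
    unfolding eventually_at_right_field
  proof (intro exI[of _ 1] conjI allI impI)
    fix t :: real assume t: "0 < t" "t < 1"
    have "\<phi> t = h ((1 - t) *\<^sub>R y + t *\<^sub>R x)"
      by (simp add: \<phi>_def algebra_simps)
    also have "\<dots> \<le> (1 - t) * h y + t * h x"
      using t S by (intro convex_onD[OF conv]) auto
    finally show "(\<phi> t - \<phi> 0) / t \<le> h x - h y"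
      using t by (simp add: \<phi>_def field_simps)
  qed simp
  then have "inner (x - y) d \<le> h x - h y"
    by (intro tendsto_upperbound[OF lim]) auto
  then show ?thesis by (simp add: inner_diff_left)
qed

lemma minimizers_eq_Inf:
  assumes "x \<in> minimizers h"
  shows "(INF z. h z) = h x"
  using assms by (intro antisym INF_lower INF_greatest) (auto simp: minimizers_def)

lemma composite_eq_PInfty_iff: "composite h1 h2 x = \<infinity> \<longleftrightarrow> x \<notin> effective_domain h2"
  by (cases "h2 x") (auto simp: composite_def effective_domain_def)

section \<open>Finiteness of the optimal values\<close>

context simple_bilevel
begin

abbreviation "f \<equiv> composite f1 f2"
abbreviation "g \<equiv> composite g1 g2"
abbreviation "argmin_g \<equiv> minimizers g"
abbreviation "dom_g \<equiv> effective_domain g2"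
abbreviation "slope \<equiv> slope_bound f1 g2 lf2"

text \<open>Real versions of the three optimal values. Since \<open>real_of_ereal\<close> sends
  infinities to 0, they become meaningful only through \<open>Inf_f_eq\<close>,
  \<open>Inf_g_eq\<close> and \<open>optimal_value_eq\<close>.\<close>

definition fstar :: real where "fstar = real_of_ereal (INF x. f x)"
definition gstar :: real where "gstar = real_of_ereal (INF x. g x)"
definition pstar :: real where "pstar = real_of_ereal (optimal_value f1 f2 g1 g2)"

lemma f2_neq_MInfty: "f2 x \<noteq> -\<infinity>" and g2_neq_MInfty: "g2 x \<noteq> -\<infinity>"
  using nonsmooth by (auto simp: prox_admissible_def proper_def)

lemma dom_g_nonempty: "dom_g \<noteq> {}"
  using nonsmooth by (auto simp: prox_admissible_def proper_def)

lemma Inf_f_eq: "(INF x. f x) = ereal fstar"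
proof -
  obtain x where "x \<in> dom_g" using dom_g_nonempty by blast
  then have "f x < \<infinity>" using f2_finite by (auto simp: composite_eq_PInfty_iff)
  then have "(INF x. f x) < \<infinity>" by (meson INF_lower UNIV_I le_less_trans)
  then show ?thesis
    using f_bounded_below unfolding fstar_def by (subst ereal_real') auto
qed

lemma Inf_g_eq: "(INF x. g x) = ereal gstar"
proof -
  obtain x where "x \<in> dom_g" using dom_g_nonempty by blast
  then have "g x < \<infinity>" by (auto simp: composite_eq_PInfty_iff)
  then have "(INF x. g x) < \<infinity>" by (meson INF_lower UNIV_I le_less_trans)
  then show ?thesis
    using g_bounded_below unfolding gstar_def by (subst ereal_real') auto
qed

lemma fstar_le: "ereal fstar \<le> f x" and gstar_le: "ereal gstar \<le> g x"
  unfolding Inf_f_eq[symmetric] Inf_g_eq[symmetric] by (auto intro: INF_lower)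

lemma ereal_real_f: "x \<in> effective_domain f2 \<Longrightarrow> ereal (real_of_ereal (f x)) = f x"
  using fstar_le[of x] composite_eq_PInfty_iff[of f1 f2 x] by (cases "f x") auto

lemma minimizer_value: "x \<in> argmin_g \<Longrightarrow> g x = ereal gstar"
  using minimizers_eq_Inf Inf_g_eq by metis

lemma argmin_g_subset: "argmin_g \<subseteq> dom_g"
proof
  fix x assume "x \<in> argmin_g"
  then have "g x \<noteq> \<infinity>" by (simp add: minimizer_value)
  then show "x \<in> dom_g" by (simp add: composite_eq_PInfty_iff)
qed

lemma argmin_g_nonempty: "argmin_g \<noteq> {}"
  using several_minimizers by blast

text \<open>Finite from above because minimizers of \<open>g\<close> exist and lie in
  \<open>dom_g\<close>, where \<open>f\<close> is finite; finite from below by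
  \<open>fstar\<close>.\<close>

lemma optimal_value_eq: "optimal_value f1 f2 g1 g2 = ereal pstar"
proof -
  obtain x where x: "x \<in> argmin_g" using argmin_g_nonempty by blast
  then have "f x < \<infinity>"
    using argmin_g_subset f2_finite by (auto simp: composite_eq_PInfty_iff)
  with x have "optimal_value f1 f2 g1 g2 < \<infinity>"
    unfolding optimal_value_def by (meson INF_lower le_less_trans)
  moreover have "ereal fstar \<le> optimal_value f1 f2 g1 g2"
    unfolding optimal_value_def by (intro INF_greatest fstar_le)
  ultimately show ?thesis
    unfolding pstar_def by (subst ereal_real') auto
qed

lemma pstar_le: "x \<in> argmin_g \<Longrightarrow> ereal pstar \<le> f x"
  unfolding optimal_value_eq[symmetric] optimal_value_def by (rule INF_lower)

lemma le_pstarI: "(\<And>x. x \<in> argmin_g \<Longrightarrow> ereal c \<le> f x) \<Longrightarrow> c \<le> pstar"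
  using INF_greatest[of argmin_g "ereal c" f] optimal_value_eq
  unfolding optimal_value_def by simp

lemma fstar_le_pstar: "fstar \<le> pstar"
  by (rule le_pstarI) (rule fstar_le)

section \<open>Lipschitz estimate for \<open>f\<close> and its consequence under the error
  bound\<close>

lemma norm_gradient_le:
  assumes "x \<in> dom_g"
  shows "norm (gradient f1 x) \<le> slope - lf2"
proof -
  have lip: "Lf-lipschitz_on dom_g (gradient f1)"
    using smooth(1) dom_subset(2) by (auto simp: smooth_convex_on_def intro: lipschitz_on_subset)
  \<comment> \<open>A real supremum is an upper bound only for a set bounded above. Here the bound
    comes from a Lipschitz map on a bounded domain.\<close>
  have "bounded (gradient f1 ` dom_g)"
    using lipschitz_on_uniformly_continuous[OF lip] dom_bounded
    by (rule bounded_uniformly_continuous_image)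
  then have "bdd_above ((\<lambda>x. norm (gradient f1 x)) ` dom_g)"
    by (auto simp: bounded_iff bdd_above_def)
  from cSUP_upper[OF assms this] show ?thesis by (simp add: slope_bound_def)
qed

lemma f_slope_le:
  assumes x: "x \<in> dom_g" and y: "y \<in> dom_g"
  shows "real_of_ereal (f y) \<le> real_of_ereal (f x) + slope * dist x y"
proof -
  have split: "real_of_ereal (f z) = f1 z + real_of_ereal (f2 z)" if "z \<in> dom_g" for z
    using that f2_finite f2_neq_MInfty[of z]
    by (cases "f2 z") (auto simp: composite_def effective_domain_def)
  have "\<exists>d. GDERIV f1 y :> d"
    using smooth(1) y dom_subset(2) unfolding smooth_convex_on_def by blast
  then have "GDERIV f1 y :> gradient f1 y" by (auto intro: GDERIV_gradient)
  moreover have "convex_on X f1" using smooth(1) by (simp add: smooth_convex_on_def)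
  ultimately have "f1 y - f1 x \<le> inner (y - x) (gradient f1 y)"
    using x y dom_subset(2) by (intro convex_on_gradient_le[of X]) auto
  also have "\<dots> \<le> norm (y - x) * norm (gradient f1 y)" by (rule norm_cauchy_schwarz)
  also have "\<dots> \<le> norm (y - x) * (slope - lf2)"
    using norm_gradient_le[OF y] by (rule mult_left_mono) simp
  finally have "f1 y - f1 x \<le> (slope - lf2) * dist x y"
    by (simp add: dist_norm norm_minus_commute mult.commute)
  moreover have "real_of_ereal (f2 y) - real_of_ereal (f2 x) \<le> lf2 * dist x y"
    using lipschitz_onD[OF f2_lipschitz x y] by (simp add: dist_real_def)
  ultimately show ?thesis using split[OF x] split[OF y] by (simp add: algebra_simps)
qed

text \<open>\<open>f_slope_le\<close> is applied to minimizers that are nearest to \<open>x\<close>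
  up to a slack of \<open>e / slope\<close>, which costs \<open>e\<close> in the value of
  \<open>f\<close>.\<close>

lemma pstar_le_infdist:
  assumes x: "x \<in> dom_g" and slope: "slope > 0"
  shows "pstar \<le> real_of_ereal (f x) + slope * infdist x argmin_g"
proof (rule field_le_epsilon)
  fix e :: real assume "e > 0"
  then have "infdist x argmin_g < infdist x argmin_g + e / slope" using slope by simp
  then have "Inf (dist x ` argmin_g) < infdist x argmin_g + e / slope"
    using argmin_g_nonempty by (simp add: infdist_notempty)
  then obtain y where y: "y \<in> argmin_g" and "dist x y < infdist x argmin_g + e / slope"
    using argmin_g_nonempty by (subst (asm) cInf_less_iff) auto
  then have "slope * dist x y \<le> slope * (infdist x argmin_g + e / slope)"
    using slope by (intro mult_left_mono) auto
  also have "\<dots> = slope * infdist x argmin_g + e" using slope by (simp add: field_simps)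
  finally have "slope * dist x y \<le> slope * infdist x argmin_g + e" .
  moreover have "y \<in> dom_g" using y argmin_g_subset by auto
  moreover have "pstar \<le> real_of_ereal (f y)"
    using pstar_le[OF y] ereal_real_f[of y] \<open>y \<in> dom_g\<close> f2_finite
    by (metis ereal_less_eq(3) subsetD)
  ultimately show "pstar \<le> real_of_ereal (f x) + slope * infdist x argmin_g + e"
    using f_slope_le[OF x, of y] by linarith
qed

text \<open>This explains the choice of \<epsilon>g: inverting the error bound at this level gives
  distance at most \<open>\<epsilon> / slope\<close>, hence a change of at most \<epsilon> in
  \<open>f\<close>.\<close>

lemma pstar_le_near_minimizer:
  assumes g: "g x \<le> ereal (gstar + \<alpha> / r * (\<epsilon> / slope) powr r)" and pos: "slope > 0" "\<epsilon> > 0"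
  shows "pstar \<le> real_of_ereal (f x) + \<epsilon>"
proof -
  have "g x \<noteq> \<infinity>" using g by auto
  then have x: "x \<in> dom_g" by (simp add: composite_eq_PInfty_iff)
  have "ereal (\<alpha> / r * infdist x argmin_g powr r) \<le> ereal (\<alpha> / r * (\<epsilon> / slope) powr r)"
    using error_bound[OF x] g unfolding Inf_g_eq by (cases "g x") auto
  then have "infdist x argmin_g powr r \<le> (\<epsilon> / slope) powr r"
    using error_bound_parameters by (simp add: mult_le_cancel_left divide_simps)
  then have "infdist x argmin_g \<le> \<epsilon> / slope"
    \<comment> \<open>By contraposition: a larger distance would have a strictly larger
      power.\<close>
    using powr_less_mono2[of r "\<epsilon> / slope" "infdist x argmin_g"] error_bound_parameters pos
    by (smt (verit) divide_pos_pos)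
  then have "slope * infdist x argmin_g \<le> \<epsilon>" using pos by (simp add: field_simps)
  then show ?thesis using pstar_le_infdist[OF x pos(1)] by linarith
qed

text \<open>Bounds the initial bisection interval by a quantity that does not depend on the
  tolerances. The normalization \<open>D \<ge> 1\<close> serves the count of passes.\<close>

lemma f_bounded_on_dom_g:
  obtains D where "D \<ge> 1" "\<And>x. x \<in> dom_g \<Longrightarrow> real_of_ereal (f x) \<le> fstar + D"
proof -
  obtain z where z: "z \<in> dom_g" using dom_g_nonempty by blast
  obtain R where R: "\<And>x. x \<in> dom_g \<Longrightarrow> dist z x \<le> R"
    using dom_bounded by (auto simp: bounded_any_center[where a=z])
  define D where "D = max 1 (real_of_ereal (f z) + \<bar>slope\<bar> * R - fstar)"
  show ?thesis
  proof (rule that[of D])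
    fix x assume x: "x \<in> dom_g"
    have "slope * dist z x \<le> \<bar>slope\<bar> * R"
      using R[OF x] by (intro mult_mono) auto
    then show "real_of_ereal (f x) \<le> fstar + D"
      using f_slope_le[OF z x] by (simp add: D_def)
  qed (simp add: D_def)
qed

end


section \<open>Accuracy and cost of the oracle calls\<close>

lemma ereal_diff_leD: "x - ereal m \<le> ereal \<delta> \<Longrightarrow> x \<le> ereal (m + \<delta>)"
  by (cases x) auto

text \<open>The factor 3 counts the kinds of unit operations. The absolute value keeps the bound
  nonnegative for \<open>L \<ge> 0\<close> and \<open>\<delta> > 0\<close>, as the sign of
  \<open>K\<close> is not prescribed.\<close>

definition apg_cost_bound :: "real \<Rightarrow> nat \<Rightarrow> real \<Rightarrow> real \<Rightarrow> real" where
  "apg_cost_bound K M L \<delta> = 3 * real M * (\<bar>K\<bar> * sqrt (L / \<delta>) + 1)"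

lemma apg_specD:
  assumes spec: "apg_spec X easy K M \<phi>1 \<phi>2 L \<delta> out"
    and prems: "smooth_convex_on X L \<phi>1" "prox_admissible easy \<phi>2"
      "effective_domain \<phi>2 \<subseteq> X" "\<delta> > 0"
  shows "composite \<phi>1 \<phi>2 (point out) - (INF x. composite \<phi>1 \<phi>2 x) \<le> ereal \<delta>"
    and "real (unit_ops out) \<le> apg_cost_bound K M L \<delta>"
proof -
  have *: "composite \<phi>1 \<phi>2 (point out) - (INF x. composite \<phi>1 \<phi>2 x) \<le> ereal \<delta>"
      "real (iterations out) \<le> K * sqrt (L / \<delta>) + 1"
      "fun_evals out \<le> M * iterations out" "grad_evals out \<le> M * iterations out"
      "prox_calls out \<le> M * iterations out"
    using spec prems unfolding apg_spec_def by blast+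
  then show "composite \<phi>1 \<phi>2 (point out) - (INF x. composite \<phi>1 \<phi>2 x) \<le> ereal \<delta>" by simp
  have "L \<ge> 0" using prems(1) by (auto simp: smooth_convex_on_def lipschitz_on_def)
  then have "K * sqrt (L / \<delta>) \<le> \<bar>K\<bar> * sqrt (L / \<delta>)"
    using prems(4) by (intro mult_right_mono) auto
  then have iter: "real (iterations out) \<le> \<bar>K\<bar> * sqrt (L / \<delta>) + 1" using *(2) by linarith
  have "unit_ops out \<le> 3 * M * iterations out"
    using *(3-5) by (simp add: unit_ops_def)
  then have "real (unit_ops out) \<le> 3 * real M * real (iterations out)"
    by (metis of_nat_le_iff of_nat_mult of_nat_numeral)
  also have "\<dots> \<le> apg_cost_bound K M L \<delta>"
    unfolding apg_cost_bound_def using iter by (intro mult_left_mono) auto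
  finally show "real (unit_ops out) \<le> apg_cost_bound K M L \<delta>" .
qed

text \<open>One run at fixed tolerances. The oracle is trusted only on the calls that this run
  makes, so each use of \<open>oracle_correct\<close> must first exhibit its call in
  \<open>oracle_calls\<close>.\<close>

locale bisec_bio_run =
  simple_bilevel X f1 f2 g1 g2 Lf Lg lf2 \<alpha> r easy +
  bisec_bio f1 f2 g1 g2 Lf Lg APG x0f x0g x0c \<epsilon>f \<epsilon>g
  for X :: "'a::euclidean_space set" and f1 f2 g1 g2 Lf Lg lf2 \<alpha> r easy
    and APG :: "'a apg" and x0f x0g x0c \<epsilon>f \<epsilon>g +
  fixes K :: real and M :: nat
  assumes slope_pos: "slope_bound f1 g2 lf2 > 0"
    and eps_f_pos: "\<epsilon>f > 0"
    and eps_g_eq: "\<epsilon>g = \<alpha> / r * (\<epsilon>f / slope_bound f1 g2 lf2) powr r"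
    and oracle_correct: "\<And>\<phi>1 \<phi>2 L x0 \<delta>. (\<phi>1, \<phi>2, L, x0, \<delta>) \<in> oracle_calls \<Longrightarrow>
      prox_admissible easy \<phi>2 \<and> apg_spec X easy K M \<phi>1 \<phi>2 L \<delta> (APG \<phi>1 \<phi>2 L x0 \<delta>)"
begin

lemma eps_g_pos: "\<epsilon>g > 0"
  using error_bound_parameters slope_pos eps_f_pos by (simp add: eps_g_eq)

lemma out_f_bounds:
  "f (point out_f) \<le> ereal (fstar + \<epsilon>f / 2)"
  "real (unit_ops out_f) \<le> apg_cost_bound K M Lf (\<epsilon>f / 2)"
proof -
  have "(f1, f2, Lf, x0f, \<epsilon>f / 2) \<in> oracle_calls" by (simp add: oracle_calls_def)
  then have o: "prox_admissible easy f2" "apg_spec X easy K M f1 f2 Lf (\<epsilon>f / 2) out_f"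
    using oracle_correct unfolding out_f_def by blast+
  note * = apg_specD[OF o(2) smooth(1) o(1) dom_subset(1)]
  show "f (point out_f) \<le> ereal (fstar + \<epsilon>f / 2)"
    using *(1) eps_f_pos by (intro ereal_diff_leD) (simp add: Inf_f_eq)
  show "real (unit_ops out_f) \<le> apg_cost_bound K M Lf (\<epsilon>f / 2)"
    using *(2) eps_f_pos by simp
qed

lemma out_g_bounds:
  "g (point out_g) \<le> ereal (gstar + \<epsilon>g / 2)"
  "real (unit_ops out_g) \<le> apg_cost_bound K M Lg (\<epsilon>g / 2)"
proof -
  have "(g1, g2, Lg, x0g, \<epsilon>g / 2) \<in> oracle_calls" by (simp add: oracle_calls_def)
  then have o: "prox_admissible easy g2" "apg_spec X easy K M g1 g2 Lg (\<epsilon>g / 2) out_g"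
    using oracle_correct unfolding out_g_def by blast+
  note * = apg_specD[OF o(2) smooth(2) o(1) dom_subset(2)]
  show "g (point out_g) \<le> ereal (gstar + \<epsilon>g / 2)"
    using *(1) eps_g_pos by (intro ereal_diff_leD) (simp add: Inf_g_eq)
  show "real (unit_ops out_g) \<le> apg_cost_bound K M Lg (\<epsilon>g / 2)"
    using *(2) eps_g_pos by simp
qed

lemma composite_h: "composite g1 (h c) x = (if f x \<le> ereal c then g x else \<infinity>)"
  using g2_neq_MInfty[of x]
  by (cases "g2 x") (auto simp: composite_def h_def sublevel_indicator_def)

text \<open>Properness of \<open>h c\<close> supplies a feasible point, so the constrained infimum
  is a real number \<open>m\<close>. The output then has a finite objective value, which forces
  feasibility, and its excess over \<open>m\<close> is at most
  \<open>\<epsilon>g / 2\<close>.\<close>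

lemma out_c_bounds:
  fixes k
  defines "c \<equiv> mid (state k)"
  defines "out \<equiv> out_c k c"
  assumes run: "\<forall>j\<le>k. running (state j)"
  shows "f (point out) \<le> ereal c"
    and "\<And>y. f y \<le> ereal c \<Longrightarrow> g (point out) \<le> g y + ereal (\<epsilon>g / 2)"
    and "real (unit_ops out) \<le> apg_cost_bound K M Lg (\<epsilon>g / 2)"
proof -
  let ?\<phi> = "composite g1 (h c)"
  have "(g1, h c, Lg, x0c k, \<epsilon>g / 2) \<in> oracle_calls"
    using run by (auto simp: oracle_calls_def c_def)
  then have o: "prox_admissible easy (h c)" "apg_spec X easy K M g1 (h c) Lg (\<epsilon>g / 2) out"
    using oracle_correct unfolding out_def out_c_def by blast+
  have dom: "effective_domain (h c) \<subseteq> X"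
  proof
    fix x assume "x \<in> effective_domain (h c)"
    then have "x \<in> dom_g" by (auto simp: effective_domain_def h_def sublevel_indicator_def split: if_splits)
    then show "x \<in> X" using dom_subset by auto
  qed
  note * = apg_specD[OF o(2) smooth(2) o(1) dom]
  show "real (unit_ops out) \<le> apg_cost_bound K M Lg (\<epsilon>g / 2)"
    using *(2) eps_g_pos by simp
  obtain z where "z \<in> effective_domain (h c)"
    using o(1) by (auto simp: prox_admissible_def proper_def)
  then have "?\<phi> z < \<infinity>" using composite_eq_PInfty_iff[of g1 "h c" z] by auto
  then have "(INF x. ?\<phi> x) < \<infinity>" by (meson INF_lower UNIV_I le_less_trans)
  moreover have "ereal gstar \<le> (INF x. ?\<phi> x)"
    by (intro INF_greatest) (simp add: composite_h gstar_le)
  ultimately obtain m where m: "(INF x. ?\<phi> x) = ereal m"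
    by (cases "INF x. ?\<phi> x") auto
  have le: "?\<phi> (point out) \<le> ereal (m + \<epsilon>g / 2)"
    using *(1) eps_g_pos by (intro ereal_diff_leD) (simp add: m)
  then show f: "f (point out) \<le> ereal c" by (auto simp: composite_h split: if_splits)
  fix y assume y: "f y \<le> ereal c"
  have "ereal m \<le> ?\<phi> y" unfolding m[symmetric] by (rule INF_lower) simp
  then have "ereal m \<le> g y" using y by (simp add: composite_h)
  then have "ereal (m + \<epsilon>g / 2) \<le> g y + ereal (\<epsilon>g / 2)" by (cases "g y") auto
  then show "g (point out) \<le> g y + ereal (\<epsilon>g / 2)"
    using le f by (auto simp: composite_h)
qed

section \<open>Loop invariant, halving and termination\<close>

definition valid :: "'a bisec_state \<Rightarrow> bool" where
  "valid s \<longleftrightarrow> lower s \<le> pstar \<and> f (incumbent s) = ereal (upper s) \<and>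
     g (incumbent s) \<le> ereal (gstar + \<epsilon>g)"

lemma f_finite: "g x \<le> ereal b \<Longrightarrow> f x = ereal (real_of_ereal (f x))"
  using composite_eq_PInfty_iff[of g1 g2 x] f2_finite ereal_real_f[of x] by auto

lemma valid_initial: "valid initial"
proof -
  have "f (point out_f) \<noteq> \<infinity>" using out_f_bounds(1) by auto
  then have "real_of_ereal (f (point out_f)) - \<epsilon>f / 2 \<le> fstar"
    using out_f_bounds(1) fstar_le[of "point out_f"] by (cases "f (point out_f)") auto
  moreover have "g (point out_g) \<le> ereal (gstar + \<epsilon>g)"
    using out_g_bounds(1) eps_g_pos by (cases "g (point out_g)") auto
  ultimately show ?thesis
    using fstar_le_pstar f_finite[OF out_g_bounds(1)] by (simp add: valid_def initial_def)
qed

text \<open>The width halves in the second branch as well: there \<open>upper\<close> becomes the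
  \<open>f\<close>-value of the new point, which is at most the midpoint.\<close>

lemma pass_step:
  assumes run: "\<forall>j\<le>k. running (state j)" and valid: "valid (state k)"
  shows "valid (state (Suc k))"
    and "upper (state (Suc k)) - lower (state (Suc k)) \<le> (upper (state k) - lower (state k)) / 2"
    and "real (cost (state (Suc k))) \<le> real (cost (state k)) + (apg_cost_bound K M Lg (\<epsilon>g / 2) + 2)"
proof -
  let ?s = "state k"
  define c where "c = mid ?s"
  define out where "out = out_c k c"
  define x where "x = point out"
  note b = out_c_bounds[OF run, folded c_def, folded out_def, folded x_def]
  have c: "c = (lower ?s + upper ?s) / 2" by (simp add: c_def mid_def)
  have "valid (state (Suc k)) \<and>
    upper (state (Suc k)) - lower (state (Suc k)) \<le> (upper ?s - lower ?s) / 2 \<and>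
    cost (state (Suc k)) \<le> cost ?s + unit_ops out + 2"
  proof (cases "g x > g (point out_g) + ereal (\<epsilon>g / 2)")
    case True
    then have s: "state (Suc k) = ?s\<lparr>lower := c, cost := cost ?s + unit_ops out + 1\<rparr>"
      by (simp add: pass_def Let_def c_def out_def x_def)
    \<comment> \<open>A minimizer of \<open>g\<close> with \<open>f\<close>-value below
      \<open>c\<close> would be feasible for the oracle call, and the output would then pass the
      acceptance test.\<close>
    have "c \<le> pstar"
    proof (rule le_pstarI, rule ccontr)
      fix y assume y: "y \<in> argmin_g" "\<not> ereal c \<le> f y"
      then have "g x \<le> g y + ereal (\<epsilon>g / 2)" by (intro b(2)) auto
      also have "\<dots> \<le> g (point out_g) + ereal (\<epsilon>g / 2)"
        using y(1) by (intro add_right_mono) (auto simp: minimizers_def)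
      finally show False using True by simp
    qed
    then show ?thesis
      using valid unfolding s by (simp add: valid_def c field_simps)
  next
    case False
    then have s: "state (Suc k) = ?s\<lparr>upper := real_of_ereal (f x), incumbent := x,
        cost := cost ?s + unit_ops out + 2\<rparr>"
      by (simp add: pass_def Let_def c_def out_def x_def)
    \<comment> \<open>One half of \<epsilon>g comes from the acceptance test, the other from the
      reference point \<open>point out_g\<close>.\<close>
    have g: "g x \<le> ereal (gstar + \<epsilon>g)"
      using False out_g_bounds(1) by (cases "g x"; cases "g (point out_g)") auto
    have "real_of_ereal (f x) \<le> c"
      using b(1) f_finite[OF g] by (metis ereal_less_eq(3))
    then show ?thesis
      using valid g f_finite[OF g] unfolding s by (simp add: valid_def c field_simps)
  qed
  then show "valid (state (Suc k))"
    and "upper (state (Suc k)) - lower (state (Suc k)) \<le> (upper ?s - lower ?s) / 2"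
    and "real (cost (state (Suc k))) \<le> real (cost ?s) + (apg_cost_bound K M Lg (\<epsilon>g / 2) + 2)"
    using b(3) by auto
qed

lemma state_bounds:
  assumes "\<forall>j<k. running (state j)"
  shows "valid (state k) \<and>
    upper (state k) - lower (state k) \<le> (upper initial - lower initial) / 2 ^ k \<and>
    real (cost (state k)) \<le> real (cost initial) + real k * (apg_cost_bound K M Lg (\<epsilon>g / 2) + 2)"
  using assms
proof (induction k)
  case 0
  then show ?case using valid_initial by simp
next
  case (Suc k)
  then have IH: "valid (state k)"
    "upper (state k) - lower (state k) \<le> (upper initial - lower initial) / 2 ^ k"
    "real (cost (state k)) \<le> real (cost initial) + real k * (apg_cost_bound K M Lg (\<epsilon>g / 2) + 2)"
    by auto
  have "\<forall>j\<le>k. running (state j)" using Suc.prems by auto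
  note step = pass_step[OF this IH(1)]
  show ?case
  proof (intro conjI)
    show "valid (state (Suc k))" by (rule step(1))
    have "(upper (state k) - lower (state k)) / 2 \<le> (upper initial - lower initial) / 2 ^ Suc k"
      using divide_right_mono[OF IH(2), of 2] by (simp add: mult.commute)
    with step(2) show "upper (state (Suc k)) - lower (state (Suc k))
        \<le> (upper initial - lower initial) / 2 ^ Suc k"
      by (rule order_trans)
    show "real (cost (state (Suc k)))
        \<le> real (cost initial) + real (Suc k) * (apg_cost_bound K M Lg (\<epsilon>g / 2) + 2)"
      using step(3) IH(3) by (simp add: distrib_right del: state.simps)
  qed
qed

text \<open>The extra \<open>\<epsilon>f / 2\<close> is the amount by which the initial
  \<open>lower\<close> is shifted down.\<close>

lemma initial_width:
  assumes "\<And>x. x \<in> dom_g \<Longrightarrow> real_of_ereal (f x) \<le> fstar + D"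
  shows "upper initial - lower initial \<le> D + \<epsilon>f / 2"
proof -
  have "point out_g \<in> dom_g"
    using out_g_bounds(1) composite_eq_PInfty_iff[of g1 g2 "point out_g"] by auto
  then have "upper initial \<le> fstar + D" using assms by (simp add: initial_def)
  moreover have "fstar - \<epsilon>f / 2 \<le> lower initial"
    using out_f_bounds(1) fstar_le[of "point out_f"]
    by (cases "f (point out_f)") (auto simp: initial_def)
  ultimately show ?thesis by simp
qed

lemma terminates: "\<exists>T. (\<forall>k<T. running (state k)) \<and> \<not> running (state T)"
proof -
  have "\<exists>T. \<not> running (state T)"
  proof (rule ccontr)
    assume "\<not> ?thesis"
    then have run: "running (state k)" for k by blast
    obtain k where k: "(upper initial - lower initial) / \<epsilon>f < 2 ^ k"
      using real_arch_pow[of 2] by auto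
    have "\<epsilon>f < (upper initial - lower initial) / 2 ^ k"
      using run[of k] state_bounds[of k] run unfolding running_def
      by (meson less_le_trans)
    then show False using k eps_f_pos by (simp add: field_simps)
  qed
  then show ?thesis
    using exists_least_iff[of "\<lambda>T. \<not> running (state T)"] by blast
qed

lemma returns_solution:
  assumes D: "\<And>x. x \<in> dom_g \<Longrightarrow> real_of_ereal (f x) \<le> fstar + D"
  obtains x N T where "returns x N"
    and "\<bar>f x - optimal_value f1 f2 g1 g2\<bar> \<le> ereal \<epsilon>f"
    and "g x - (INF z. g z) \<le> ereal \<epsilon>g"
    and "real N \<le> apg_cost_bound K M Lf (\<epsilon>f / 2) + apg_cost_bound K M Lg (\<epsilon>g / 2) + 3 +
      real T * (apg_cost_bound K M Lg (\<epsilon>g / 2) + 2)"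
    and "T = 0 \<or> \<epsilon>f * 2 ^ T \<le> 2 * D + \<epsilon>f"
proof -
  obtain T where T: "\<forall>k<T. running (state k)" "\<not> running (state T)"
    using terminates by blast
  let ?s = "state T"
  let ?x = "incumbent ?s"
  note b = state_bounds[OF T(1)]
  have valid: "lower ?s \<le> pstar" "f ?x = ereal (upper ?s)" "g ?x \<le> ereal (gstar + \<epsilon>g)"
    using b by (auto simp: valid_def)
  show ?thesis
  proof (rule that)
    show "returns ?x (cost ?s)" using T by (auto simp: returns_def)
    \<comment> \<open>\<open>upper\<close> may drop below \<open>pstar\<close>, since the incumbent
      minimizes \<open>g\<close> only approximately; the error bound limits the drop.\<close>
    have "pstar \<le> upper ?s + \<epsilon>f"
      using pstar_le_near_minimizer[OF _ slope_pos eps_f_pos, of ?x] valid by (simp add: eps_g_eq)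
    moreover have "upper ?s \<le> pstar + \<epsilon>f" using T(2) valid(1) by (simp add: running_def)
    ultimately show "\<bar>f ?x - optimal_value f1 f2 g1 g2\<bar> \<le> ereal \<epsilon>f"
      by (simp add: valid(2) optimal_value_eq)
    show "g ?x - (INF z. g z) \<le> ereal \<epsilon>g"
      using valid(3) unfolding Inf_g_eq by (cases "g ?x") auto
    show "real (cost ?s) \<le> apg_cost_bound K M Lf (\<epsilon>f / 2) + apg_cost_bound K M Lg (\<epsilon>g / 2) + 3 +
      real T * (apg_cost_bound K M Lg (\<epsilon>g / 2) + 2)"
      using b out_f_bounds(2) out_g_bounds(2) by (simp add: initial_def)
    \<comment> \<open>The loop was still running at \<open>T - 1\<close>, so the width bound is
      applied there and then doubled.\<close>
    show "T = 0 \<or> \<epsilon>f * 2 ^ T \<le> 2 * D + \<epsilon>f"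
    proof (cases T)
      case (Suc k)
      then have "\<epsilon>f < upper (state k) - lower (state k)" using T(1) by (simp add: running_def)
      also have "\<dots> \<le> (upper initial - lower initial) / 2 ^ k"
        using state_bounds[of k] T(1) Suc by auto
      also have "\<dots> \<le> (D + \<epsilon>f / 2) / 2 ^ k"
        using initial_width[OF D] by (intro divide_right_mono) auto
      finally have "\<epsilon>f * 2 ^ k < D + \<epsilon>f / 2" by (simp add: field_simps)
      then show ?thesis by (simp add: Suc)
    qed simp
  qed
qed

end

section \<open>Number of passes and total complexity\<close>

lemma bisection_steps_le:
  fixes \<epsilon> D :: real
  assumes T: "T = 0 \<or> \<epsilon> * 2 ^ T \<le> 2 * D + \<epsilon>"
    and D: "D \<ge> 1" and \<epsilon>: "0 < \<epsilon>" "\<epsilon> < exp (- 1)" "\<epsilon> < 1 / D"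
  shows "real T + 2 \<le> 8 * ln (1 / \<epsilon>)"
proof -
  let ?l = "ln (1 / \<epsilon>)"
  have "ln \<epsilon> < ln (exp (- 1))" using \<epsilon> by (subst ln_less_cancel_iff) auto
  \<comment> \<open>Additive constants can now be absorbed into multiples of the logarithm.\<close>
  then have l: "?l \<ge> 1" using \<epsilon> by (simp add: ln_div)
  show ?thesis
  proof (cases "T = 0")
    case True
    then show ?thesis using l by simp
  next
    case False
    have "exp (- 1) \<le> (1::real)" by simp
    then have "\<epsilon> * 2 ^ T \<le> 4 * D" using T False D \<epsilon> by linarith
    \<comment> \<open>Trading \<open>D\<close> for \<open>1 / \<epsilon>\<close> doubles the
      logarithm but makes the final constant 8 independent of \<open>D\<close>.\<close>
    also have "\<dots> \<le> 4 / \<epsilon>" using \<epsilon> D by (simp add: field_simps)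
    finally have "2 ^ T \<le> 2 ^ 2 * (1 / \<epsilon>) * (1 / \<epsilon>)" using \<epsilon> by (simp add: field_simps)
    then have "ln (2 ^ T) \<le> ln (2 ^ 2 * (1 / \<epsilon>) * (1 / \<epsilon>))"
      using \<epsilon> by (subst ln_le_cancel_iff) auto
    also have "\<dots> = 2 * ln 2 + 2 * ?l"
      using \<epsilon> ln_realpow[of 2 2] by (simp add: ln_mult ln_div)
    finally have "(real T - 2) * ln 2 \<le> 2 * ?l" by (simp add: ln_realpow algebra_simps)
    moreover have "(real T - 2) * (1 / 2) \<le> (real T - 2) * ln 2" if "real T \<ge> 2"
      using that ln2_ge_two_thirds by (intro mult_left_mono) auto
    ultimately show ?thesis using l by (cases "real T \<ge> 2") auto
  qed
qed

text \<open>The order of quantifiers carries the asymptotics: \<open>C\<close> is fixed before the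
  problem and depends only on the listed parameters, while the threshold \<epsilon>0 may depend on
  the problem. Accuracy holds for every positive \<epsilon>f, the cost bound below the
  threshold.\<close>

theorem corollary1:
  fixes Lf Lg \<alpha> r B K :: real and M :: nat
  shows "\<exists>C. \<forall>(X :: 'a::euclidean_space set) f1 f2 g1 g2 lf2 easy.
    simple_bilevel X f1 f2 g1 g2 Lf Lg lf2 \<alpha> r easy \<and>
    B = slope_bound f1 g2 lf2 \<and> B > 0 \<longrightarrow>
    (\<exists>\<epsilon>0>0. \<forall>\<epsilon>f>0. \<forall>\<epsilon>g APG x0f x0g x0c.
       \<epsilon>g = \<alpha> / r * (\<epsilon>f / B) powr r \<and>
       (\<forall>(\<phi>1, \<phi>2, L, x0, \<delta>) \<in> bisec_bio.oracle_calls f1 f2 g1 g2 Lf Lg APG x0f x0g x0c \<epsilon>f \<epsilon>g.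
          prox_admissible easy \<phi>2 \<and> apg_spec X easy K M \<phi>1 \<phi>2 L \<delta> (APG \<phi>1 \<phi>2 L x0 \<delta>)) \<longrightarrow>
       (\<exists>xhat N. bisec_bio.returns f1 f2 g1 g2 Lf Lg APG x0f x0g x0c \<epsilon>f \<epsilon>g xhat N \<and>
          \<bar>composite f1 f2 xhat - optimal_value f1 f2 g1 g2\<bar> \<le> ereal \<epsilon>f \<and>
          composite g1 g2 xhat - (INF x. composite g1 g2 x) \<le> ereal \<epsilon>g \<and>
          (\<epsilon>f < \<epsilon>0 \<longrightarrow> real N \<le> C * ln (1 / \<epsilon>f) * (1 / sqrt (\<epsilon>f powr r)))))"
proof -
  \<comment> \<open>The summands are the coefficients of \<open>sqrt (L / \<delta>)\<close> at the
    tolerances \<open>\<epsilon>f / 2\<close> and \<open>\<epsilon>g / 2\<close>. In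
    \<open>A\<close>, the final 3 covers the evaluations outside the oracle.\<close>
  define S where "S = sqrt (2 * Lf) + sqrt (2 * Lg * r / \<alpha> * B powr r)"
  define A where "A = 3 * real M * (\<bar>K\<bar> * S + 1) + 3"
  show ?thesis
  proof (rule exI[of _ "8 * A"], intro allI impI, elim conjE)
    fix X :: "'a set" and f1 f2 g1 g2 lf2 easy
    assume "simple_bilevel X f1 f2 g1 g2 Lf Lg lf2 \<alpha> r easy"
      and B: "B = slope_bound f1 g2 lf2" "B > 0"
    then interpret simple_bilevel X f1 f2 g1 g2 Lf Lg lf2 \<alpha> r easy by simp
    obtain D where D: "D \<ge> 1" "\<And>x. x \<in> effective_domain g2 \<Longrightarrow> real_of_ereal (composite f1 f2 x) \<le> fstar + D"
      using f_bounded_on_dom_g by blast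
    have L: "Lf \<ge> 0" "Lg \<ge> 0"
      using smooth by (auto simp: smooth_convex_on_def lipschitz_on_def)
    note par = error_bound_parameters
    show "\<exists>\<epsilon>0>0. \<forall>\<epsilon>f>0. \<forall>\<epsilon>g APG x0f x0g x0c.
       \<epsilon>g = \<alpha> / r * (\<epsilon>f / B) powr r \<and>
       (\<forall>(\<phi>1, \<phi>2, L, x0, \<delta>) \<in> bisec_bio.oracle_calls f1 f2 g1 g2 Lf Lg APG x0f x0g x0c \<epsilon>f \<epsilon>g.
          prox_admissible easy \<phi>2 \<and> apg_spec X easy K M \<phi>1 \<phi>2 L \<delta> (APG \<phi>1 \<phi>2 L x0 \<delta>)) \<longrightarrow>
       (\<exists>xhat N. bisec_bio.returns f1 f2 g1 g2 Lf Lg APG x0f x0g x0c \<epsilon>f \<epsilon>g xhat N \<and>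
          \<bar>composite f1 f2 xhat - optimal_value f1 f2 g1 g2\<bar> \<le> ereal \<epsilon>f \<and>
          composite g1 g2 xhat - (INF x. composite g1 g2 x) \<le> ereal \<epsilon>g \<and>
          (\<epsilon>f < \<epsilon>0 \<longrightarrow> real N \<le> 8 * A * ln (1 / \<epsilon>f) * (1 / sqrt (\<epsilon>f powr r))))"
    proof (rule exI[of _ "min (exp (- 1)) (1 / D)"], intro conjI allI impI, goal_cases)
      case 1
      then show ?case using D(1) by simp
    next
      case (2 \<epsilon>f \<epsilon>g APG x0f x0g x0c)
      then have \<epsilon>f: "\<epsilon>f > 0" and \<epsilon>g: "\<epsilon>g = \<alpha> / r * (\<epsilon>f / B) powr r" by auto
      interpret bisec_bio_run X f1 f2 g1 g2 Lf Lg lf2 \<alpha> r easy APG x0f x0g x0c \<epsilon>f \<epsilon>g K M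
        using 2 B by unfold_locales auto
      obtain x N T where sol: "bisec_bio.returns f1 f2 g1 g2 Lf Lg APG x0f x0g x0c \<epsilon>f \<epsilon>g x N"
          "\<bar>composite f1 f2 x - optimal_value f1 f2 g1 g2\<bar> \<le> ereal \<epsilon>f"
          "composite g1 g2 x - (INF x. composite g1 g2 x) \<le> ereal \<epsilon>g"
        and N: "real N \<le> apg_cost_bound K M Lf (\<epsilon>f / 2) + apg_cost_bound K M Lg (\<epsilon>g / 2) + 3 +
          real T * (apg_cost_bound K M Lg (\<epsilon>g / 2) + 2)"
        and T: "T = 0 \<or> \<epsilon>f * 2 ^ T \<le> 2 * D + \<epsilon>f"
        using returns_solution[OF D(2)] by blast
      have "real N \<le> 8 * A * ln (1 / \<epsilon>f) * (1 / sqrt (\<epsilon>f powr r))"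
        if small: "\<epsilon>f < min (exp (- 1)) (1 / D)"
      proof -
        define P where "P = 1 / sqrt (\<epsilon>f powr r)"
        have "exp (- 1) \<le> (1::real)" by simp
        then have "\<epsilon>f < 1" using small by linarith
        then have pow: "\<epsilon>f powr r \<le> \<epsilon>f" "\<epsilon>f powr r \<le> 1"
          using \<epsilon>f par powr_mono'[of 1 r \<epsilon>f] by (auto intro: powr_le1)
        \<comment> \<open>As \<open>r \<ge> 1\<close> and \<open>\<epsilon>f < 1\<close>, the rate
          of the calls for \<open>g\<close> dominates that of the call for \<open>f\<close>.\<close>
        then have P: "P \<ge> 1" "1 / sqrt \<epsilon>f \<le> P"
          using \<epsilon>f by (auto simp: P_def intro!: divide_left_mono)
        have S: "sqrt (2 * Lf) \<le> S" "sqrt (2 * Lg * r / \<alpha> * B powr r) \<le> S" "S \<ge> 0"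
          using L par by (auto simp: S_def)
        have cost: "apg_cost_bound K M L' \<delta> + 3 \<le> A * P" if "sqrt (L' / \<delta>) \<le> S * P" for L' \<delta>
        proof -
          have "\<bar>K\<bar> * sqrt (L' / \<delta>) \<le> \<bar>K\<bar> * (S * P)"
            using that by (intro mult_left_mono) auto
          then have "\<bar>K\<bar> * sqrt (L' / \<delta>) + 1 \<le> (\<bar>K\<bar> * S + 1) * P"
            using P(1) by (simp add: distrib_right)
          then have "3 * real M * (\<bar>K\<bar> * sqrt (L' / \<delta>) + 1) \<le> 3 * real M * ((\<bar>K\<bar> * S + 1) * P)"
            by (intro mult_left_mono) auto
          then show ?thesis
            using P(1) by (simp add: apg_cost_bound_def A_def distrib_right mult.assoc)
        qed
        have "sqrt (Lf / (\<epsilon>f / 2)) = sqrt (2 * Lf) * (1 / sqrt \<epsilon>f)"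
          by (simp add: real_sqrt_divide real_sqrt_mult field_simps)
        also have "\<dots> \<le> S * P" using S P L \<epsilon>f by (intro mult_mono) auto
        finally have costf: "apg_cost_bound K M Lf (\<epsilon>f / 2) + 3 \<le> A * P" by (rule cost)
        have "Lg / (\<epsilon>g / 2) = (2 * Lg * r / \<alpha> * B powr r) / \<epsilon>f powr r"
          using \<epsilon>f B(2) par by (simp add: \<epsilon>g powr_divide field_simps)
        then have "sqrt (Lg / (\<epsilon>g / 2)) = sqrt (2 * Lg * r / \<alpha> * B powr r) * P"
          by (simp only: P_def real_sqrt_divide times_divide_eq_right mult_1_right)
        also have "\<dots> \<le> S * P" using S P by (intro mult_right_mono) auto
        finally have costg: "apg_cost_bound K M Lg (\<epsilon>g / 2) + 3 \<le> A * P" by (rule cost)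
        have "A * P \<ge> 0" using S P(1) by (simp add: A_def)
        have "real T * (apg_cost_bound K M Lg (\<epsilon>g / 2) + 2) \<le> real T * (A * P)"
          using costg by (intro mult_left_mono) auto
        \<comment> \<open>Two initial calls and \<open>T\<close> passes, each of cost at most
          \<open>A * P\<close>.\<close>
        then have "real N \<le> (real T + 2) * (A * P)"
          using N costf costg by (simp add: distrib_right)
        also have "\<dots> \<le> (8 * ln (1 / \<epsilon>f)) * (A * P)"
          using bisection_steps_le[OF T D(1) \<epsilon>f] small \<open>A * P \<ge> 0\<close> by (intro mult_right_mono) auto
        finally show ?thesis by (simp add: P_def mult_ac)
      qed
      then show ?case using sol by blast
    qed
  qed
qed

end
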